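(* Let $\beta,\gamma\in(0,1)$, let the supply and demand assumptions in the context hold, and let $p_{\rm bal}\le p_L<p_H$. Then in the throughput game $(L,L)$ is always a Nash equilibrium and $(H,H)$ is never a Nash equilibrium. Moreover (first entry: Platform 1's price, second entry: Platform 2's price): 1. $(L,H)$ is a Nash equilibrium iff $\max\left\{1-\dfrac{c(p_H)}{c(p_L)},0\right\}\le\beta<1$. 2. $(H,L)$ is a Nash equilibrium iff $0<\beta\le\min\left\{1,\dfrac{c(p_H)}{c(p_L)}\right\}$.
   Context: Supply and demand assumptions. $w(p)>0$ (supply) and $c(p)>0$ (demand) are real-valued functions of the price $p>0$; $c$ is strictly decreasing, $w$ is strictly increasing; $0<p_L<p_H$; there is a unique price $p_{\rm bal}$ with $w(\gamma p_{\rm bal})=c(p_{\rm bal})$. Throughput game. Two platforms simultaneously choose a strategy in $\{L,H\}$, i.e. a price $p_1$ (Platform 1), $p_2$ (Platform 2) in $\{p_L,p_H\}$. Given $(p_1,p_2)$, the throughput of Platform 1 is $$N_1(p_1,p_2)=\min\Big\{w(\gamma p_1),\tfrac{\beta}{1-\beta}w(\gamma p_2),c(p_1),\tfrac{\beta}{1-\beta}c(p_2),\beta c(\min\{p_1,p_2\}),\beta w(\max\{\gamma p_1,\gamma p_2\})\Big\}$$ and the throughput of Platform 2 is $N_2(p_1,p_2)=\frac{1-\beta}{\beta}N_1(p_1,p_2)$. (These are the numbers of matched worker–customer pairs at the two platforms in the aggregate-utility-maximizing allocation of users under customer loyalty $\beta$.) The payoff of Platform $i$ is its throughput $N_i$.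 A pair of strategies is a (pure strategy) Nash equilibrium if no platform can strictly increase its payoff by a unilateral change of strategy. *)

theory Defs
  imports Complex_Main
begin

definition supply_demand ::
  "real \<Rightarrow> (real \<Rightarrow> real) \<Rightarrow> (real \<Rightarrow> real) \<Rightarrow> real \<Rightarrow> bool" where
  "supply_demand \<gamma> w c p_bal \<longleftrightarrow>
     (\<forall>p>0. w p > 0) \<and> (\<forall>p>0. c p > 0) \<and>
     strict_mono_on {0<..} w \<and> strict_antimono_on {0<..} c \<and>
     p_bal > 0 \<and> w (\<gamma> * p_bal) = c p_bal \<and>
     (\<forall>p>0. w (\<gamma> * p) = c p \<longrightarrow> p = p_bal)"

definition N1 :: "real \<Rightarrow> real \<Rightarrow> (real \<Rightarrow> real) \<Rightarrow> (real \<Rightarrow> real) \<Rightarrow> real \<Rightarrow> real \<Rightarrow> real" where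
  "N1 \<beta> \<gamma> w c p1 p2 =
     Min {w (\<gamma> * p1), \<beta> / (1 - \<beta>) * w (\<gamma> * p2),
          c p1, \<beta> / (1 - \<beta>) * c p2,
          \<beta> * c (min p1 p2), \<beta> * w (max (\<gamma> * p1) (\<gamma> * p2))}"

definition N2 :: "real \<Rightarrow> real \<Rightarrow> (real \<Rightarrow> real) \<Rightarrow> (real \<Rightarrow> real) \<Rightarrow> real \<Rightarrow> real \<Rightarrow> real" where
  "N2 \<beta> \<gamma> w c p1 p2 = (1 - \<beta>) / \<beta> * N1 \<beta> \<gamma> w c p1 p2"

datatype strategy = L | H

fun price :: "real \<Rightarrow> real \<Rightarrow> strategy \<Rightarrow> real" where
  "price p_L p_H L = p_L"
| "price p_L p_H H = p_H"

definition nash_equilibrium ::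
  "('s \<Rightarrow> 't \<Rightarrow> real) \<Rightarrow> ('s \<Rightarrow> 't \<Rightarrow> real) \<Rightarrow> 's \<times> 't \<Rightarrow> bool" where
  "nash_equilibrium u1 u2 = (\<lambda>(s1, s2).
     \<not> (\<exists>s1'. u1 s1' s2 > u1 s1 s2) \<and> \<not> (\<exists>s2'. u2 s1 s2' > u2 s1 s2))"

definition throughput_nash ::
  "real \<Rightarrow> real \<Rightarrow> (real \<Rightarrow> real) \<Rightarrow> (real \<Rightarrow> real) \<Rightarrow> real \<Rightarrow> real \<Rightarrow> strategy \<times> strategy \<Rightarrow> bool" where
  "throughput_nash \<beta> \<gamma> w c p_L p_H =
     nash_equilibrium
       (\<lambda>s1 s2. N1 \<beta> \<gamma> w c (price p_L p_H s1) (price p_L p_H s2))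
       (\<lambda>s1 s2. N2 \<beta> \<gamma> w c (price p_L p_H s1) (price p_L p_H s2))"

end

theory Submission
  imports Defs
begin

text \<open>
  Raising the price from \<open>p_bal\<close>, where supply equals demand, increases supply and decreases demand.
  Hence \<open>c p \<le> w (\<gamma> * p)\<close> at both prices of the game, so no supply term in the minimum lies below all demand terms and
  the game depends on the demand alone. Writing \<open>a = c p_L > b = c p_H\<close>, Platform 1's throughput is

    \<open>N1(L,L) = \<beta> a\<close>, \<open>N1(H,H) = \<beta> b\<close>,
    \<open>N1(L,H) = min (\<beta> / (1 - \<beta>) b) (\<beta> a)\<close>, \<open>N1(H,L) = min b (\<beta> a)\<close>.

  Platform 2's throughput is a positive multiple of Platform 1's, so the two platforms
  rank the four outcomes in the same way. It follows that \<open>(L,L)\<close>, which attains the largest value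
  \<open>\<beta> a\<close>, is an equilibrium, that \<open>(H,H)\<close>, whose value \<open>\<beta> b\<close> is strictly smaller than both mixed
  values, is not, and that a mixed outcome is an equilibrium exactly when it also attains \<open>\<beta> a\<close>.
  For \<open>(L,H)\<close> this means \<open>(1 - \<beta>) a \<le> b\<close>, and for \<open>(H,L)\<close> it means \<open>\<beta> a \<le> b\<close>.
\<close>

lemma demand_le_supply_above_balance:
  assumes sd: "supply_demand \<gamma> w c p_bal" and \<gamma>: "0 < \<gamma>" and p: "p_bal \<le> p"
  shows "c p \<le> w (\<gamma> * p)"
proof (cases "p = p_bal")
  case True
  then show ?thesis using sd by (simp add: supply_demand_def)
next
  case False
  with p have less: "p_bal < p" by simp
  have pos: "0 < p_bal" and w: "strict_mono_on {0<..} w" and c: "strict_antimono_on {0<..} c"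
    and bal: "w (\<gamma> * p_bal) = c p_bal"
    using sd by (auto simp: supply_demand_def)
  have "c p < c p_bal"
    using monotone_onD[OF c _ _ less] pos less by simp
  also have "\<dots> = w (\<gamma> * p_bal)" using bal by simp
  also have "\<dots> < w (\<gamma> * p)"
    using strict_mono_onD[OF w, of "\<gamma> * p_bal" "\<gamma> * p"] pos less \<gamma> by simp
  finally show ?thesis by simp
qed

text \<open>
  The supply terms of the two platforms lie above the matching demand terms. The
  joint supply term lies above the joint demand term because the larger price attracts at least as many workers as the
  smaller one, which in turn attracts enough workers for the demand at that smaller price.
\<close>

lemma N1_eq_demand_terms:
  assumes \<beta>: "0 < \<beta>" "\<beta> < 1" and \<gamma>: "0 < \<gamma>"
    and w: "strict_mono_on {0<..} w"
    and pos: "0 < p1" "0 < p2"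
    and excess: "c p1 \<le> w (\<gamma> * p1)" "c p2 \<le> w (\<gamma> * p2)"
  shows "N1 \<beta> \<gamma> w c p1 p2 =
    min (c p1) (min (\<beta> / (1 - \<beta>) * c p2) (\<beta> * c (min p1 p2)))"
proof -
  have mono: "w x \<le> w y" if "0 < x" "x \<le> y" for x y
    using strict_mono_on_leD[OF w, of x y] that by simp
  have "c (min p1 p2) \<le> w (\<gamma> * min p1 p2)"
    using excess by (simp add: min_def)
  also have "\<dots> \<le> w (max (\<gamma> * p1) (\<gamma> * p2))"
    using pos \<gamma> by (intro mono) (auto simp: min_def le_max_iff_disj)
  finally have joint: "\<beta> * c (min p1 p2) \<le> \<beta> * w (max (\<gamma> * p1) (\<gamma> * p2))"
    using \<beta> by simp
  have other: "\<beta> / (1 - \<beta>) * c p2 \<le> \<beta> / (1 - \<beta>) * w (\<gamma> * p2)"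
    using excess \<beta> by (intro mult_left_mono) auto
  show ?thesis
    using joint other excess(1) by (simp add: N1_def)
qed

lemma N1_equal_prices:
  assumes \<beta>: "0 < \<beta>" "\<beta> < 1" and \<gamma>: "0 < \<gamma>"
    and w: "strict_mono_on {0<..} w"
    and p: "0 < p" "0 < c p" "c p \<le> w (\<gamma> * p)"
  shows "N1 \<beta> \<gamma> w c p p = \<beta> * c p"
proof -
  have "\<beta> \<le> \<beta> / (1 - \<beta>)" using \<beta> by (simp add: field_simps)
  then have "\<beta> * c p \<le> \<beta> / (1 - \<beta>) * c p"
    using p by (intro mult_right_mono) auto
  moreover have "\<beta> * c p \<le> c p" using \<beta> p by simp
  ultimately show ?thesis
    using N1_eq_demand_terms[OF \<beta> \<gamma> w, of p p c] p by simp
qed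

text \<open>
  Since \<open>N2\<close> is a positive multiple of \<open>N1\<close>, the single function \<open>N1\<close> decides whether either platform can gain by deviating.
\<close>

lemma throughput_nash_iff_N1:
  assumes "0 < \<beta>" "\<beta> < 1"
  shows "throughput_nash \<beta> \<gamma> w c p_L p_H (s1, s2) \<longleftrightarrow>
    (\<forall>s. N1 \<beta> \<gamma> w c (price p_L p_H s) (price p_L p_H s2)
       \<le> N1 \<beta> \<gamma> w c (price p_L p_H s1) (price p_L p_H s2)) \<and>
    (\<forall>s. N1 \<beta> \<gamma> w c (price p_L p_H s1) (price p_L p_H s)
       \<le> N1 \<beta> \<gamma> w c (price p_L p_H s1) (price p_L p_H s2))"
proof -
  have "0 < (1 - \<beta>) / \<beta>" using assms by simp
  then have "N2 \<beta> \<gamma> w c p q < N2 \<beta> \<gamma> w c p' q' \<longleftrightarrow> N1 \<beta> \<gamma> w c p q < N1 \<beta> \<gamma> w c p' q'"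
    for p q p' q'
    unfolding N2_def by (rule mult_less_cancel_left_pos)
  then show ?thesis
    by (simp add: throughput_nash_def nash_equilibrium_def not_less)
qed

lemma all_strategy_iff: "(\<forall>s. P s) \<longleftrightarrow> P L \<and> P H"
  by (metis strategy.exhaust)

theorem theorem4:
  fixes \<beta> \<gamma> p_L p_H p_bal :: real and w c :: "real \<Rightarrow> real"
  assumes "0 < \<beta>" and "\<beta> < 1" and "0 < \<gamma>" and "\<gamma> < 1"
    and "supply_demand \<gamma> w c p_bal"
    and "0 < p_L" and "p_bal \<le> p_L" and "p_L < p_H"
  shows "throughput_nash \<beta> \<gamma> w c p_L p_H (L, L) \<and>
         \<not> throughput_nash \<beta> \<gamma> w c p_L p_H (H, H) \<and>
         (throughput_nash \<beta> \<gamma> w c p_L p_H (L, H) \<longleftrightarrow>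
            max (1 - c p_H / c p_L) 0 \<le> \<beta> \<and> \<beta> < 1) \<and>
         (throughput_nash \<beta> \<gamma> w c p_L p_H (H, L) \<longleftrightarrow>
            0 < \<beta> \<and> \<beta> \<le> min 1 (c p_H / c p_L))"
proof -
  note \<beta> = assms(1,2) and \<gamma> = assms(3) and sd = assms(5)
  define a b where "a = c p_L" and "b = c p_H"
  have pH: "0 < p_H" using assms by simp
  have w: "strict_mono_on {0<..} w" and c: "strict_antimono_on {0<..} c"
    and b_pos: "0 < b" and a_pos: "0 < a"
    using sd assms(6) pH by (auto simp: supply_demand_def a_def b_def)
  have ba: "b < a"
    using monotone_onD[OF c _ _ assms(8)] assms(6) pH by (simp add: a_def b_def)
  have excess: "c p_L \<le> w (\<gamma> * p_L)" "c p_H \<le> w (\<gamma> * p_H)"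
    using demand_le_supply_above_balance[OF sd \<gamma>] assms by auto
  have pos_demand: "0 < c p_L" "0 < c p_H"
    using a_pos b_pos by (simp_all add: a_def b_def)

  have LL: "N1 \<beta> \<gamma> w c p_L p_L = \<beta> * a"
    unfolding a_def using assms(6) pos_demand excess by (intro N1_equal_prices \<beta> \<gamma> w)
  have HH: "N1 \<beta> \<gamma> w c p_H p_H = \<beta> * b"
    unfolding b_def using pH pos_demand excess by (intro N1_equal_prices \<beta> \<gamma> w)
  have "\<beta> * a < a" using \<beta> a_pos by simp
  then have LH: "N1 \<beta> \<gamma> w c p_L p_H = min (\<beta> / (1 - \<beta>) * b) (\<beta> * a)"
    using N1_eq_demand_terms[OF \<beta> \<gamma> w, of p_L p_H c] assms(6,8) pH excess
    by (simp add: a_def b_def min_def)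
  have \<beta>_less: "\<beta> < \<beta> / (1 - \<beta>)" using \<beta> by (simp add: field_simps)
  then have "\<beta> * a < \<beta> / (1 - \<beta>) * a"
    using a_pos by (rule mult_strict_right_mono)
  then have HL: "N1 \<beta> \<gamma> w c p_H p_L = min b (\<beta> * a)"
    using N1_eq_demand_terms[OF \<beta> \<gamma> w, of p_H p_L c] assms(6,8) pH excess
    by (simp add: a_def b_def min_def)

  have "\<beta> * b < \<beta> / (1 - \<beta>) * b" using \<beta>_less b_pos by (rule mult_strict_right_mono)
  moreover have "\<beta> * b < \<beta> * a" using ba \<beta> by simp
  moreover have "\<beta> * b < b" using \<beta> b_pos by simp
  ultimately have HH_least: "\<beta> * b < min (\<beta> / (1 - \<beta>) * b) (\<beta> * a)" "\<beta> * b < min b (\<beta> * a)"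
    by simp_all

  note nash = throughput_nash_iff_N1[OF \<beta>] all_strategy_iff price.simps LL LH HL HH
  have "throughput_nash \<beta> \<gamma> w c p_L p_H (L, L)"
    unfolding nash by simp
  moreover have "\<not> throughput_nash \<beta> \<gamma> w c p_L p_H (H, H)"
    unfolding nash using HH_least by linarith
  moreover have "throughput_nash \<beta> \<gamma> w c p_L p_H (L, H) \<longleftrightarrow>
      max (1 - c p_H / c p_L) 0 \<le> \<beta> \<and> \<beta> < 1"
  proof -
    have "throughput_nash \<beta> \<gamma> w c p_L p_H (L, H) \<longleftrightarrow> \<beta> * a \<le> \<beta> / (1 - \<beta>) * b"
      unfolding nash using HH_least by auto
    also have "\<dots> \<longleftrightarrow> a \<le> b / (1 - \<beta>)"
      using mult_le_cancel_left_pos[OF \<beta>(1), of a "b / (1 - \<beta>)"] by simp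
    also have "\<dots> \<longleftrightarrow> (1 - \<beta>) * a \<le> b"
      using \<beta> by (simp add: pos_le_divide_eq mult.commute)
    also have "\<dots> \<longleftrightarrow> 1 - b / a \<le> \<beta>"
      using a_pos by (simp add: field_simps)
    finally show ?thesis using \<beta> by (simp add: a_def b_def)
  qed
  moreover have "throughput_nash \<beta> \<gamma> w c p_L p_H (H, L) \<longleftrightarrow>
      0 < \<beta> \<and> \<beta> \<le> min 1 (c p_H / c p_L)"
  proof -
    have "throughput_nash \<beta> \<gamma> w c p_L p_H (H, L) \<longleftrightarrow> \<beta> * a \<le> b"
      unfolding nash using HH_least by auto
    also have "\<dots> \<longleftrightarrow> \<beta> \<le> b / a"
      using a_pos by (simp add: field_simps)
    finally show ?thesis using \<beta> by (simp add: a_def b_def)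
  qed
  ultimately show ?thesis by blast
qed

end
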